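(* For every integer $m>3$ there exist an $m$-dimensional Riemannian manifold $(M,g)$, a conformal foliation $\mathcal{F}$ on $M$ with minimal leaves of codimension $2$, and a local orthonormal frame $\{X,Y\}$ for the horizontal distribution $\mathcal{H}$ of $\mathcal{F}$ such that the condition $$\mathrm{Ric}(X,X)=\mathrm{Ric}(Y,Y)\quad\text{and}\quad \mathrm{Ric}(X,Y)=0$$ on the Ricci curvature of $(M,g)$ fails.
   Context: Let $(M,g)$ be a Riemannian manifold with Levi-Civita connection $\nabla$, $\mathcal{V}$ an involutive distribution on $M$ and $\mathcal{H}$ its orthogonal complement (the horizontal distribution); $\mathcal{V}$ and $\mathcal{H}$ also denote the orthogonal projections of $TM$ onto these subbundles, and $\mathcal{F}$ is the foliation tangent to $\mathcal{V}$. The second fundamental forms are $B^{\mathcal{V}}(U,V)=\frac12\mathcal{H}(\nabla_UV+\nabla_VU)$ for $U,V\in\mathcal{V}$ and $B^{\mathcal{H}}(X,Y)=\frac12\mathcal{V}(\nabla_XY+\nabla_YX)$ for $X,Y\in\mathcal{H}$. The foliation $\mathcal{F}$ is conformal if there is a vector field $V\in\mathcal{V}$ with $B^{\mathcal{H}}=g\otimes V$ on $\mathcal{H}$, and it has minimal leaves if $\mathrm{trace}\,B^{\mathcal{V}}=0$. Codimension 2 means $\dim\mathcal{H}=2$. *)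

theory Defs
  imports "HOL-Analysis.Analysis"
begin

section \<open>Smooth maps on open subsets of \<open>real^'n\<close>\<close>

definition partial :: "'n::finite \<Rightarrow> (real^'n \<Rightarrow> 'b::real_normed_vector) \<Rightarrow> real^'n \<Rightarrow> 'b" where
  "partial i f x = frechet_derivative f (at x) (axis i 1)"

primrec C_k_on :: "nat \<Rightarrow> (real^'n::finite \<Rightarrow> 'b::real_normed_vector) \<Rightarrow> (real^'n) set \<Rightarrow> bool" where
  "C_k_on 0 f S \<longleftrightarrow> continuous_on S f"
| "C_k_on (Suc k) f S \<longleftrightarrow> (\<forall>x\<in>S. f differentiable (at x)) \<and> (\<forall>i. C_k_on k (partial i f) S)"

definition smooth_on :: "(real^'n::finite) set \<Rightarrow> (real^'n \<Rightarrow> 'b::real_normed_vector) \<Rightarrow> bool" where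
  "smooth_on S f \<longleftrightarrow> (\<forall>k. C_k_on k f S)"

section \<open>Riemannian geometry in a coordinate patch\<close>

text \<open>In a coordinate patch a metric is given by its Gram matrix \<open>h\<close> with respect to the
  coordinate frame, and a vector field by its vector of components.\<close>

definition ip :: "(real^'n \<Rightarrow> real^'n^'n) \<Rightarrow> real^'n::finite \<Rightarrow> real^'n \<Rightarrow> real^'n \<Rightarrow> real" where
  "ip h x \<xi> \<eta> = \<xi> \<bullet> (h x *v \<eta>)"

definition lie_bracket ::
  "(real^'n \<Rightarrow> real^'n) \<Rightarrow> (real^'n \<Rightarrow> real^'n) \<Rightarrow> real^'n \<Rightarrow> real^'n::finite" where
  "lie_bracket X Y x = frechet_derivative Y (at x) (X x) - frechet_derivative X (at x) (Y x)"

definition christoffel ::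
  "(real^'n \<Rightarrow> real^'n^'n) \<Rightarrow> real^'n::finite \<Rightarrow> 'n \<Rightarrow> 'n \<Rightarrow> 'n \<Rightarrow> real" where
  "christoffel h x k i j = (\<Sum>l\<in>UNIV. matrix_inv (h x) $ k $ l / 2 *
     (partial i (\<lambda>y. h y $ j $ l) x + partial j (\<lambda>y. h y $ i $ l) x - partial l (\<lambda>y. h y $ i $ j) x))"

text \<open>The Levi-Civita connection \<open>\<nabla>\<^sub>X Y\<close>. That it is torsion-free and metric is proved below
  (\<open>levi_civita_torsion_free\<close>, \<open>levi_civita_metric\<close>).\<close>

definition levi_civita ::
  "(real^'n \<Rightarrow> real^'n^'n) \<Rightarrow> (real^'n \<Rightarrow> real^'n) \<Rightarrow> (real^'n \<Rightarrow> real^'n) \<Rightarrow> real^'n \<Rightarrow> real^'n::finite" where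
  "levi_civita h X Y x = frechet_derivative Y (at x) (X x) +
     (\<chi> k. \<Sum>i\<in>UNIV. \<Sum>j\<in>UNIV. christoffel h x k i j * X x $ i * Y x $ j)"

definition curvature ::
  "(real^'n \<Rightarrow> real^'n^'n) \<Rightarrow> (real^'n \<Rightarrow> real^'n) \<Rightarrow> (real^'n \<Rightarrow> real^'n) \<Rightarrow> (real^'n \<Rightarrow> real^'n) \<Rightarrow>
    real^'n \<Rightarrow> real^'n::finite" where
  "curvature h X Y Z x = levi_civita h X (levi_civita h Y Z) x
     - levi_civita h Y (levi_civita h X Z) x - levi_civita h (lie_bracket X Y) Z x"

text \<open>\<open>Ric(\<xi>, \<eta>)\<close> is the trace of \<open>\<zeta> \<mapsto> R(\<zeta>, \<xi>)\<eta>\<close>. As the curvature is a tensor, tangent vectors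
  may be extended to fields with constant components.\<close>

definition ricci ::
  "(real^'n \<Rightarrow> real^'n^'n) \<Rightarrow> real^'n::finite \<Rightarrow> real^'n \<Rightarrow> real^'n \<Rightarrow> real" where
  "ricci h x \<xi> \<eta> = trace (matrix (\<lambda>\<zeta>. curvature h (\<lambda>_. \<zeta>) (\<lambda>_. \<xi>) (\<lambda>_. \<eta>) x))"

lemma partial_component:
  fixes h :: "real^'n::finite \<Rightarrow> real^'n^'n"
  assumes "h differentiable (at x)"
  shows "partial i (\<lambda>y. h y $ j $ l) x = frechet_derivative h (at x) (axis i 1) $ j $ l"
    and "(\<lambda>y. h y $ j $ l) differentiable (at x)"
proof -
  have "(h has_derivative frechet_derivative h (at x)) (at x)"
    using assms frechet_derivative_works by blast
  then have "((\<lambda>y. h y $ j $ l) has_derivative (\<lambda>v. frechet_derivative h (at x) v $ j $ l)) (at x)"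
    by (intro bounded_linear.has_derivative[OF bounded_linear_vec_nth])
  then show "partial i (\<lambda>y. h y $ j $ l) x = frechet_derivative h (at x) (axis i 1) $ j $ l"
    and "(\<lambda>y. h y $ j $ l) differentiable (at x)"
    unfolding partial_def by (auto simp: frechet_derivative_at[symmetric] differentiable_def)
qed

lemma partial_symmetric:
  fixes h :: "real^'n::finite \<Rightarrow> real^'n^'n"
  assumes "open S" "x \<in> S" "\<And>y. y \<in> S \<Longrightarrow> transpose (h y) = h y" "h differentiable (at x)"
  shows "partial i (\<lambda>y. h y $ j $ l) x = partial i (\<lambda>y. h y $ l $ j) x"
proof -
  have sym: "h y $ j $ l = h y $ l $ j" if "y \<in> S" for y
  proof -
    have "transpose (h y) $ l $ j = h y $ j $ l"
      by (simp add: transpose_def)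
    then show ?thesis
      by (simp only: assms(3)[OF that])
  qed
  have "frechet_derivative (\<lambda>y. h y $ j $ l) (at x) = frechet_derivative (\<lambda>y. h y $ l $ j) (at x)"
    by (rule frechet_derivative_transform_within_open[OF partial_component(2)[OF assms(4)] assms(1,2) sym])
  then show ?thesis
    unfolding partial_def by (simp only:)
qed

lemma levi_civita_torsion_free:
  assumes "open S" "x \<in> S" "\<And>y. y \<in> S \<Longrightarrow> transpose (h y) = h y" "h differentiable (at x)"
  shows "levi_civita h X Y x - levi_civita h Y X x = lie_bracket X Y x"
proof -
  have c: "christoffel h x k i j = christoffel h x k j i" for k i j
    unfolding christoffel_def
    by (simp add: partial_symmetric[OF assms, of _ i j] add.commute)
  have "(\<Sum>i\<in>UNIV. \<Sum>j\<in>UNIV. christoffel h x k i j * X x $ i * Y x $ j) =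
      (\<Sum>i\<in>UNIV. \<Sum>j\<in>UNIV. christoffel h x k i j * Y x $ i * X x $ j)" for k
    by (subst sum.swap) (simp add: c[of k] mult_ac)
  then show ?thesis
    unfolding levi_civita_def lie_bracket_def by simp
qed

lemma christoffel_lower:
  fixes h :: "real^'n::finite \<Rightarrow> real^'n^'n"
  assumes "invertible (h x)"
  shows "(\<Sum>k\<in>UNIV. h x $ m $ k * christoffel h x k i j) =
    (partial i (\<lambda>y. h y $ j $ m) x + partial j (\<lambda>y. h y $ i $ m) x - partial m (\<lambda>y. h y $ i $ j) x) / 2"
proof -
  define d where "d = (\<chi> l. (partial i (\<lambda>y. h y $ j $ l) x + partial j (\<lambda>y. h y $ i $ l) x
    - partial l (\<lambda>y. h y $ i $ j) x) / 2)"
  have "(\<Sum>k\<in>UNIV. h x $ m $ k * christoffel h x k i j) = (h x *v (matrix_inv (h x) *v d)) $ m"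
    by (simp add: matrix_vector_mult_def christoffel_def d_def)
  also have "h x *v (matrix_inv (h x) *v d) = d"
  proof -
    have "h x ** matrix_inv (h x) = mat 1 \<and> matrix_inv (h x) ** h x = mat 1"
      unfolding matrix_inv_def
      using someI_ex[of "\<lambda>B. h x ** B = mat 1 \<and> B ** h x = mat 1"] assms
      unfolding invertible_def by blast
    then show ?thesis by (metis matrix_vector_mul_assoc matrix_vector_mul_lid)
  qed
  finally show ?thesis by (simp add: d_def)
qed

lemma levi_civita_metric:
  fixes h :: "real^'n::finite \<Rightarrow> real^'n^'n"
  assumes S: "open S" "x \<in> S" "\<And>y. y \<in> S \<Longrightarrow> transpose (h y) = h y" and dh: "h differentiable (at x)"
    and inv: "invertible (h x)" and dY: "Y differentiable (at x)" and dZ: "Z differentiable (at x)"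
  shows "frechet_derivative (\<lambda>y. ip h y (Y y) (Z y)) (at x) (X x) =
    ip h x (levi_civita h X Y x) (Z x) + ip h x (Y x) (levi_civita h X Z x)"
proof -
  define h' Y' Z' where "h' = frechet_derivative h (at x)" and "Y' = frechet_derivative Y (at x)"
    and "Z' = frechet_derivative Z (at x)"
  have ders: "(h has_derivative h') (at x)" "(Y has_derivative Y') (at x)" "(Z has_derivative Z') (at x)"
    using dh dY dZ frechet_derivative_works unfolding h'_def Y'_def Z'_def by blast+
  have bb: "bounded_bilinear ((*v) :: real^'n^'n \<Rightarrow> real^'n \<Rightarrow> real^'n)"
    by (rule bilinear_conv_bounded_bilinear[THEN iffD1])
       (auto simp: bilinear_def linear_iff algebra_simps matrix_vector_mult_add_rdistrib
          matrix_vector_right_distrib scaleR_matrix_vector_assoc matrix_vector_mult_scaleR)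
  have "((\<lambda>y. ip h y (Y y) (Z y)) has_derivative
      (\<lambda>v. Y x \<bullet> (h x *v Z' v + h' v *v Z x) + Y' v \<bullet> (h x *v Z x))) (at x)"
    unfolding ip_def
    by (intro has_derivative_inner bounded_bilinear.FDERIV[OF bb] ders)
  then have D: "frechet_derivative (\<lambda>y. ip h y (Y y) (Z y)) (at x) =
      (\<lambda>v. Y x \<bullet> (h x *v Z' v + h' v *v Z x) + Y' v \<bullet> (h x *v Z x))"
    by (simp add: frechet_derivative_at[symmetric])
  define G where "G U = (\<chi> k. \<Sum>i\<in>UNIV. \<Sum>j\<in>UNIV. christoffel h x k i j * X x $ i * U $ j)" for U :: "real^'n"
  define p where "p i j m = partial i (\<lambda>y. h y $ j $ m) x" for i j m
  have psym: "p i j m = p i m j" for i j m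
    unfolding p_def by (rule partial_symmetric[OF S dh])
  have low: "(h x *v G U) $ m = (\<Sum>i\<in>UNIV. \<Sum>j\<in>UNIV. (p i j m + p j i m - p m i j) / 2 * X x $ i * U $ j)" for U m
  proof -
    have "(h x *v G U) $ m =
        (\<Sum>k\<in>UNIV. \<Sum>i\<in>UNIV. \<Sum>j\<in>UNIV. h x $ m $ k * christoffel h x k i j * X x $ i * U $ j)"
      by (simp add: matrix_vector_mult_def G_def sum_distrib_left mult_ac)
    also have "\<dots> = (\<Sum>i\<in>UNIV. \<Sum>j\<in>UNIV. \<Sum>k\<in>UNIV. h x $ m $ k * christoffel h x k i j * X x $ i * U $ j)"
      by (subst sum.swap) (rule sum.cong[OF refl], rule sum.swap)
    also have "\<dots> = (\<Sum>i\<in>UNIV. \<Sum>j\<in>UNIV. (\<Sum>k\<in>UNIV. h x $ m $ k * christoffel h x k i j) * X x $ i * U $ j)"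
      by (simp add: sum_distrib_right)
    finally show ?thesis
      by (simp add: christoffel_lower[where h = h, OF inv] p_def)
  qed
  have h'X: "h' (X x) $ j $ m = (\<Sum>i\<in>UNIV. p i j m * X x $ i)" for j m
  proof -
    have "linear h'"
      using ders(1) has_derivative_linear by blast
    then have "h' (X x) = (\<Sum>i\<in>UNIV. X x $ i *\<^sub>R h' (axis i 1))"
      by (subst basis_expansion[of "X x", symmetric, unfolded scalar_mult_eq_scaleR])
         (simp add: linear_sum linear_cmul)
    then show ?thesis
      by (simp add: p_def partial_component(1)[OF dh] h'_def mult_ac)
  qed
  have "Y x \<bullet> (h' (X x) *v Z x) =
      (\<Sum>j\<in>UNIV. \<Sum>m\<in>UNIV. \<Sum>i\<in>UNIV. p i j m * X x $ i * Y x $ j * Z x $ m)"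
    by (simp add: inner_vec_def matrix_vector_mult_def h'X sum_distrib_left sum_distrib_right mult_ac)
  also have "\<dots> = (\<Sum>j\<in>UNIV. \<Sum>m\<in>UNIV. \<Sum>i\<in>UNIV. (p i j m + p j i m - p m i j) / 2 * X x $ i * Y x $ j * Z x $ m)
      + (\<Sum>j\<in>UNIV. \<Sum>m\<in>UNIV. \<Sum>i\<in>UNIV. (p i m j + p m i j - p j i m) / 2 * X x $ i * Y x $ j * Z x $ m)"
    unfolding sum.distrib[symmetric]
    by (intro sum.cong refl) (simp add: psym[of _ m j for m j] field_simps)
  also have "(\<Sum>j\<in>UNIV. \<Sum>m\<in>UNIV. \<Sum>i\<in>UNIV. (p i j m + p j i m - p m i j) / 2 * X x $ i * Y x $ j * Z x $ m)
      = Z x \<bullet> (h x *v G (Y x))"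
  proof -
    have "Z x \<bullet> (h x *v G (Y x)) = (\<Sum>m\<in>UNIV. \<Sum>i\<in>UNIV. \<Sum>j\<in>UNIV. 
        (p i j m + p j i m - p m i j) / 2 * X x $ i * Y x $ j * Z x $ m)"
      by (simp add: inner_vec_def low sum_distrib_left mult_ac)
    also have "\<dots> = (\<Sum>m\<in>UNIV. \<Sum>j\<in>UNIV. \<Sum>i\<in>UNIV. 
        (p i j m + p j i m - p m i j) / 2 * X x $ i * Y x $ j * Z x $ m)"
      by (rule sum.cong[OF refl], rule sum.swap)
    finally show ?thesis
      by (subst sum.swap) simp
  qed
  also have "(\<Sum>j\<in>UNIV. \<Sum>m\<in>UNIV. \<Sum>i\<in>UNIV. (p i m j + p m i j - p j i m) / 2 * X x $ i * Y x $ j * Z x $ m)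
      = Y x \<bullet> (h x *v G (Z x))"
  proof -
    have "Y x \<bullet> (h x *v G (Z x)) = (\<Sum>j\<in>UNIV. \<Sum>i\<in>UNIV. \<Sum>m\<in>UNIV. 
        (p i m j + p m i j - p j i m) / 2 * X x $ i * Y x $ j * Z x $ m)"
      by (simp add: inner_vec_def low sum_distrib_left mult_ac)
    also have "\<dots> = (\<Sum>j\<in>UNIV. \<Sum>m\<in>UNIV. \<Sum>i\<in>UNIV. 
        (p i m j + p m i j - p j i m) / 2 * X x $ i * Y x $ j * Z x $ m)"
      by (rule sum.cong[OF refl], rule sum.swap)
    finally show ?thesis by simp
  qed
  finally have E: "Y x \<bullet> (h' (X x) *v Z x) = Z x \<bullet> (h x *v G (Y x)) + Y x \<bullet> (h x *v G (Z x))" .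
  have sw: "Z x \<bullet> (h x *v G (Y x)) = G (Y x) \<bullet> (h x *v Z x)"
  proof -
    have "Z x \<bullet> (h x *v G (Y x)) = (Z x v* transpose (h x)) \<bullet> G (Y x)"
      by (simp only: dot_lmul_matrix S(3)[OF S(2)])
    then show ?thesis
      by (simp only: vector_transpose_matrix inner_commute)
  qed
  have L: "levi_civita h X Y x = Y' (X x) + G (Y x)" "levi_civita h X Z x = Z' (X x) + G (Z x)"
    unfolding levi_civita_def Y'_def Z'_def G_def by (rule refl)+
  show ?thesis
    unfolding D L unfolding ip_def matrix_vector_right_distrib inner_add_left inner_add_right E sw
    by linarith
qed

section \<open>Smooth manifolds\<close>

text \<open>A chart is a pair of its domain and its coordinate map; \<open>coords c W\<close> is the part of the
  coordinate domain of \<open>c\<close> which describes \<open>W\<close>. The topology of a manifold is arbitrary; a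
  manifold has at most continuum many points, so up to isomorphism every manifold occurs among those
  whose points are drawn from a given type of that cardinality, such as \<open>real^'n\<close>.\<close>

type_synonym ('a, 'n) chart = "'a set \<times> ('a \<Rightarrow> real^'n)"

definition coords :: "('a, 'n::finite) chart \<Rightarrow> 'a set \<Rightarrow> (real^'n) set" where
  "coords c W = snd c ` (fst c \<inter> W)"

definition transition :: "('a, 'n::finite) chart \<Rightarrow> ('a, 'n) chart \<Rightarrow> real^'n \<Rightarrow> real^'n" where
  "transition c d = snd d \<circ> inv_into (fst c) (snd c)"

definition smooth_manifold :: "'a topology \<Rightarrow> ('a, 'n::finite) chart set \<Rightarrow> bool" where
  "smooth_manifold M A \<longleftrightarrow> Hausdorff_space M \<and> second_countable M \<and> (\<Union>c\<in>A. fst c) = topspace M \<and>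
    (\<forall>c\<in>A. openin M (fst c) \<and> open (coords c UNIV) \<and>
      homeomorphic_map (subtopology M (fst c)) (top_of_set (coords c UNIV)) (snd c)) \<and>
    (\<forall>c\<in>A. \<forall>d\<in>A. smooth_on (coords c (fst d)) (transition c d))"

text \<open>Geometric objects on a manifold are families, indexed by the charts of the atlas, of
  coordinate expressions which are compatible under changes of coordinates. Their values at charts
  outside the atlas and at points outside the coordinate domains are irrelevant.\<close>

type_synonym ('a, 'n) field = "('a, 'n) chart \<Rightarrow> real^'n \<Rightarrow> real^'n"
type_synonym ('a, 'n) metric = "('a, 'n) chart \<Rightarrow> real^'n \<Rightarrow> real^'n^'n"
type_synonym ('a, 'n) distr = "('a, 'n) chart \<Rightarrow> real^'n \<Rightarrow> (real^'n) set"

definition vector_field :: "('a, 'n::finite) chart set \<Rightarrow> 'a set \<Rightarrow> ('a, 'n) field \<Rightarrow> bool" where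
  "vector_field A W X \<longleftrightarrow> (\<forall>c\<in>A. smooth_on (coords c W) (X c)) \<and>
    (\<forall>c\<in>A. \<forall>d\<in>A. \<forall>x\<in>coords c (fst d \<inter> W).
      X d (transition c d x) = frechet_derivative (transition c d) (at x) (X c x))"

definition riemannian_metric :: "('a, 'n::finite) chart set \<Rightarrow> ('a, 'n) metric \<Rightarrow> bool" where
  "riemannian_metric A g \<longleftrightarrow>
    (\<forall>c\<in>A. smooth_on (coords c UNIV) (g c) \<and>
      (\<forall>x\<in>coords c UNIV. transpose (g c x) = g c x \<and> (\<forall>\<xi>. \<xi> \<noteq> 0 \<longrightarrow> ip (g c) x \<xi> \<xi> > 0))) \<and>
    (\<forall>c\<in>A. \<forall>d\<in>A. \<forall>x\<in>coords c (fst d). \<forall>\<xi> \<eta>.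
      ip (g d) (transition c d x) (frechet_derivative (transition c d) (at x) \<xi>)
        (frechet_derivative (transition c d) (at x) \<eta>) = ip (g c) x \<xi> \<eta>)"

definition riemannian_manifold ::
  "'a topology \<Rightarrow> ('a, 'n::finite) chart set \<Rightarrow> ('a, 'n) metric \<Rightarrow> bool" where
  "riemannian_manifold M A g \<longleftrightarrow> smooth_manifold M A \<and> riemannian_metric A g"

section \<open>Distributions and foliations\<close>

definition section_of ::
  "('a, 'n::finite) chart set \<Rightarrow> 'a set \<Rightarrow> ('a, 'n) distr \<Rightarrow> ('a, 'n) field \<Rightarrow> bool" where
  "section_of A W D X \<longleftrightarrow> vector_field A W X \<and> (\<forall>c\<in>A. \<forall>x\<in>coords c W. X c x \<in> D c x)"

text \<open>A smooth distribution of rank \<open>k\<close>: locally spanned by \<open>k\<close> pointwise independent smooth vector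
  fields. Compatibility under changes of coordinates follows from that of the spanning fields.\<close>

definition distribution ::
  "'a topology \<Rightarrow> ('a, 'n::finite) chart set \<Rightarrow> nat \<Rightarrow> ('a, 'n) distr \<Rightarrow> bool" where
  "distribution M A k D \<longleftrightarrow> (\<forall>p\<in>topspace M. \<exists>W Es. openin M W \<and> p \<in> W \<and> length Es = k \<and>
    (\<forall>E\<in>set Es. vector_field A W E) \<and>
    (\<forall>c\<in>A. \<forall>x\<in>coords c W. D c x = span ((\<lambda>E. E c x) ` set Es) \<and> dim (D c x) = k))"

definition involutive :: "'a topology \<Rightarrow> ('a, 'n::finite) chart set \<Rightarrow> ('a, 'n) distr \<Rightarrow> bool" where
  "involutive M A D \<longleftrightarrow> (\<forall>W X Y. openin M W \<longrightarrow> section_of A W D X \<longrightarrow> section_of A W D Y \<longrightarrow>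
    (\<forall>c\<in>A. \<forall>x\<in>coords c W. lie_bracket (X c) (Y c) x \<in> D c x))"

text \<open>A foliation is represented by its tangent distribution.\<close>

definition foliation :: "'a topology \<Rightarrow> ('a, 'n::finite) chart set \<Rightarrow> ('a, 'n) distr \<Rightarrow> bool" where
  "foliation M A V \<longleftrightarrow> (\<exists>k. distribution M A k V) \<and> involutive M A V"

definition horizontal :: "('a, 'n::finite) metric \<Rightarrow> ('a, 'n) distr \<Rightarrow> ('a, 'n) distr" where
  "horizontal g V c x = {\<xi>. \<forall>\<eta>\<in>V c x. ip (g c) x \<xi> \<eta> = 0}"

definition codimension ::
  "('a, 'n::finite) chart set \<Rightarrow> ('a, 'n) metric \<Rightarrow> ('a, 'n) distr \<Rightarrow> nat \<Rightarrow> bool" where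
  "codimension A g V q \<longleftrightarrow> (\<forall>c\<in>A. \<forall>x\<in>coords c UNIV. dim (horizontal g V c x) = q)"

definition orth_proj ::
  "('a, 'n::finite) metric \<Rightarrow> ('a, 'n) distr \<Rightarrow> ('a, 'n) chart \<Rightarrow> real^'n \<Rightarrow> real^'n \<Rightarrow> real^'n" where
  "orth_proj g D c x \<xi> = (THE \<eta>. \<eta> \<in> D c x \<and> (\<forall>\<zeta>\<in>D c x. ip (g c) x (\<xi> - \<eta>) \<zeta> = 0))"

definition second_fundamental_form_V ::
  "('a, 'n::finite) metric \<Rightarrow> ('a, 'n) distr \<Rightarrow> ('a, 'n) field \<Rightarrow> ('a, 'n) field \<Rightarrow> ('a, 'n) field" where
  "second_fundamental_form_V g V E F c x = (1/2) *\<^sub>R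
    orth_proj g (horizontal g V) c x (levi_civita (g c) (E c) (F c) x + levi_civita (g c) (F c) (E c) x)"

definition second_fundamental_form_H ::
  "('a, 'n::finite) metric \<Rightarrow> ('a, 'n) distr \<Rightarrow> ('a, 'n) field \<Rightarrow> ('a, 'n) field \<Rightarrow> ('a, 'n) field" where
  "second_fundamental_form_H g V X Y c x = (1/2) *\<^sub>R
    orth_proj g V c x (levi_civita (g c) (X c) (Y c) x + levi_civita (g c) (Y c) (X c) x)"

definition orthonormal_frame ::
  "'a topology \<Rightarrow> ('a, 'n::finite) chart set \<Rightarrow> ('a, 'n) metric \<Rightarrow> ('a, 'n) distr \<Rightarrow> 'a set \<Rightarrow>
    ('a, 'n) field list \<Rightarrow> bool" where
  "orthonormal_frame M A g D W Es \<longleftrightarrow> openin M W \<and> (\<forall>E\<in>set Es. section_of A W D E) \<and>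
    (\<forall>c\<in>A. \<forall>x\<in>coords c W. span ((\<lambda>E. E c x) ` set Es) = D c x \<and>
      (\<forall>i<length Es. \<forall>j<length Es. ip (g c) x ((Es ! i) c x) ((Es ! j) c x) = (if i = j then 1 else 0)))"

definition conformal ::
  "'a topology \<Rightarrow> ('a, 'n::finite) chart set \<Rightarrow> ('a, 'n) metric \<Rightarrow> ('a, 'n) distr \<Rightarrow> bool" where
  "conformal M A g V \<longleftrightarrow> (\<exists>Z. section_of A (topspace M) V Z \<and>
    (\<forall>W X Y. openin M W \<longrightarrow> section_of A W (horizontal g V) X \<longrightarrow> section_of A W (horizontal g V) Y \<longrightarrow>
      (\<forall>c\<in>A. \<forall>x\<in>coords c W.
        second_fundamental_form_H g V X Y c x = ip (g c) x (X c x) (Y c x) *\<^sub>R Z c x)))"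

text \<open>The trace is computed with respect to local orthonormal frames of the vertical distribution.\<close>

definition minimal_leaves ::
  "'a topology \<Rightarrow> ('a, 'n::finite) chart set \<Rightarrow> ('a, 'n) metric \<Rightarrow> ('a, 'n) distr \<Rightarrow> bool" where
  "minimal_leaves M A g V \<longleftrightarrow> (\<forall>W Es. orthonormal_frame M A g V W Es \<longrightarrow>
    (\<forall>c\<in>A. \<forall>x\<in>coords c W. (\<Sum>i<length Es. second_fundamental_form_V g V (Es ! i) (Es ! i) c x) = 0))"

definition ricci_condition ::
  "('a, 'n::finite) chart set \<Rightarrow> ('a, 'n) metric \<Rightarrow> 'a set \<Rightarrow> ('a, 'n) field \<Rightarrow> ('a, 'n) field \<Rightarrow> bool" where
  "ricci_condition A g W X Y \<longleftrightarrow> (\<forall>c\<in>A. \<forall>x\<in>coords c W.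
    ricci (g c) x (X c x) (X c x) = ricci (g c) x (Y c x) (Y c x) \<and>
    ricci (g c) x (X c x) (Y c x) = 0)"

end

theory Submission
  imports Defs
begin

text \<open>The counterexample is the product of the solvable geometry \<open>Sol\<close> with a flat factor. It
  belongs to a family for which everything can be computed: on \<open>real^'n\<close> take the diagonal metric \<open>\<Sum> exp (2 s_i x_p) dx_i^2\<close> with \<open>s_p = 0\<close>,
  and let the leaves be the affine subspaces on which the two coordinates \<open>x_p\<close> and \<open>x_q\<close> are
  constant, where also \<open>s_q = 0\<close>. The translations along \<open>x_p\<close> rescale the \<open>i\<close>-th leaf direction at
  rate \<open>s_i\<close>, and all the geometry is encoded in these rates.

  The metric transverse to the leaves is the constant flat metric \<open>dx_p^2 + dx_q^2\<close>, so the
  horizontal planes are totally geodesic and the foliation is conformal with the vertical field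
  \<open>Z = 0\<close> (\<open>conformal_sol_metric\<close>). The trace of \<open>B\<^sup>V\<close> is minus the gradient of
  the logarithm of the volume element of the leaves, which is the multiple \<open>- \<Sum> s_i\<close> of the
  horizontal vector \<open>e_p\<close>; the leaves are therefore minimal when the rates cancel (\<open>minimal_leaves_sol_metric\<close>). The
  Ricci curvature, however, sees the squares of the rates: \<open>\<nabla>_\<xi> e_p\<close> has the components
  \<open>s_k \<xi>_k\<close>, so \<open>R(\<zeta>, e_p) e_p\<close> has the components \<open>- s_k^2 \<zeta>_k\<close> and
  \<open>Ric(e_p, e_p) = - \<Sum> s_i^2\<close> (\<open>ricci_sol_metric_along\<close>), whereas \<open>e_q\<close> is parallel and
  \<open>Ric(e_q, e_q) = 0\<close> (\<open>ricci_sol_metric_flat\<close>).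

  With two leaf directions \<open>u\<close>, \<open>v\<close> available, which is what \<open>m > 3\<close> provides, the rates
  \<open>s_u = 1\<close>, \<open>s_v = - 1\<close> and zero elsewhere cancel without vanishing, and \<open>Ric(e_p, e_p) = - 2\<close>.\<close>

section \<open>Smoothness of basic maps\<close>

lemma has_derivative_vec_lambda:
  fixes f :: "'n::finite \<Rightarrow> 'a::real_normed_vector \<Rightarrow> 'b::euclidean_space"
  assumes "\<And>i. (f i has_derivative f' i) (at x)"
  shows "((\<lambda>x. \<chi> i. f i x) has_derivative (\<lambda>v. \<chi> i. f' i v)) (at x)"
  by (subst has_derivative_componentwise_within)
     (auto simp: Basis_vec_def inner_axis intro!: has_derivative_inner_left assms)

lemma C_k_on_const: "C_k_on k (\<lambda>_. a) S"
proof (induction k arbitrary: a)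
  case (Suc k)
  have "partial i (\<lambda>_. a) = (\<lambda>_. 0)" for i :: 'a
    by (rule ext) (simp add: partial_def)
  with Suc show ?case by simp
qed simp

lemma smooth_on_const: "smooth_on S (\<lambda>_. a)"
  by (simp add: smooth_on_def C_k_on_const)

lemma smooth_on_id: "smooth_on S id"
  unfolding smooth_on_def
proof
  fix k
  have "partial i id = (\<lambda>_. axis i (1::real))" for i :: 'a
    by (rule ext) (simp add: partial_def)
  then show "C_k_on k (id :: real^'a \<Rightarrow> _) S"
    by (cases k) (auto simp: C_k_on_const id_def intro: continuous_on_id)
qed

lemma smooth_on_imp_differentiable:
  assumes "smooth_on S f" "x \<in> S"
  shows "f differentiable (at x)"
proof -
  have "C_k_on (Suc 0) f S" using assms(1) unfolding smooth_on_def by blast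
  then show ?thesis using assms(2) by simp
qed

section \<open>Coordinate subspaces\<close>

definition coord_space :: "'n set \<Rightarrow> (real^'n::finite) set" where
  "coord_space I = {\<xi>. \<forall>i. i \<notin> I \<longrightarrow> \<xi> $ i = 0}"

lemma axis_in_coord_space [simp]: "axis i a \<in> coord_space I \<longleftrightarrow> i \<in> I \<or> a = 0"
  by (auto simp: coord_space_def axis_def)

lemma subspace_coord_space: "subspace (coord_space I)"
  by (auto simp: coord_space_def subspace_def)

lemma dim_coord_space: "dim (coord_space I) = card I"
  using dim_substandard_cart[where 'a = real, of I] by (simp add: coord_space_def dim_vec_eq)

lemma span_axes: "span ((\<lambda>i. axis i (1::real)) ` I) = coord_space I"
proof
  show "span ((\<lambda>i. axis i (1::real)) ` I) \<subseteq> coord_space I"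
    by (intro span_minimal subspace_coord_space) auto
  show "coord_space I \<subseteq> span ((\<lambda>i. axis i (1::real)) ` I)"
  proof
    fix \<xi> :: "real^'a" assume \<xi>: "\<xi> \<in> coord_space I"
    have "(\<Sum>i\<in>UNIV. \<xi> $ i *\<^sub>R axis i (1::real)) \<in> span ((\<lambda>i. axis i (1::real)) ` I)"
    proof (rule span_sum)
      fix i show "\<xi> $ i *\<^sub>R axis i (1::real) \<in> span ((\<lambda>i. axis i (1::real)) ` I)"
        using \<xi> by (cases "i \<in> I") (auto simp: coord_space_def span_zero intro: span_mul span_base)
    qed
    then show "\<xi> \<in> span ((\<lambda>i. axis i (1::real)) ` I)"
      using basis_expansion[of \<xi>] by (simp add: scalar_mult_eq_scaleR)
  qed
qed

text \<open>A coordinate subspace is closed under differentiation of fields with values in it. This one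
  fact makes the coordinate distributions involutive and removes the derivative terms from the
  covariant derivatives in both second fundamental forms.\<close>

lemma frechet_derivative_in_coord_space:
  assumes "open U" "x \<in> U" "f differentiable (at x)" "\<And>y. y \<in> U \<Longrightarrow> f y \<in> coord_space I"
  shows "frechet_derivative f (at x) v \<in> coord_space I"
  unfolding coord_space_def
proof safe
  fix i assume i: "i \<notin> I"
  have "((\<lambda>y. f y $ i) has_derivative (\<lambda>v. frechet_derivative f (at x) v $ i)) (at x)"
    using assms(3) frechet_derivative_works
    by (intro bounded_linear.has_derivative[OF bounded_linear_vec_nth]) blast
  then have "((\<lambda>_. 0) has_derivative (\<lambda>v. frechet_derivative f (at x) v $ i)) (at x)"
    by (rule has_derivative_transform_within_open[OF _ assms(1,2)])
       (use assms(4) i in \<open>auto simp: coord_space_def\<close>)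
  then have "(\<lambda>v. frechet_derivative f (at x) v $ i) = (\<lambda>v. 0)"
    by (rule has_derivative_unique) (rule has_derivative_const)
  then show "frechet_derivative f (at x) v $ i = 0" by (rule fun_cong)
qed

section \<open>The diagonal exponential metric\<close>

text \<open>For three coordinates \<open>u\<close>, \<open>v\<close>, \<open>p\<close> and the rates \<open>1\<close>, \<open>- 1\<close>, \<open>0\<close> this is the standard
  left-invariant metric of the three-dimensional group \<open>Sol\<close>.\<close>

definition sol_metric :: "('n \<Rightarrow> real) \<Rightarrow> 'n \<Rightarrow> real^'n \<Rightarrow> real^'n^'n::finite" where
  "sol_metric s p x = (\<chi> i j. if i = j then exp (2 * s i * x $ p) else 0)"

lemma if_zero_mult: "(if P then a else 0) * b = (if P then a * b else (0::real))"
  and mult_if_zero: "b * (if P then a else 0) = (if P then b * a else (0::real))"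
  and if_zero_divide: "(if P then a else 0) / b = (if P then a / b else (0::real))"
  and sum_if_zero: "(\<Sum>x\<in>S. if P then f x else 0) = (if P then \<Sum>x\<in>S. f x else (0::real))"
  by simp_all

lemma ip_sol_metric:
  "ip (sol_metric s p) x \<xi> \<eta> = (\<Sum>i\<in>UNIV. exp (2 * s i * x $ p) * \<xi> $ i * \<eta> $ i)"
  by (simp add: ip_def sol_metric_def inner_vec_def matrix_vector_mult_def if_zero_mult)
    (simp add: mult_ac)

text \<open>The coefficients \<open>c i\<close> make this family of matrix functions closed under partial derivatives;
  smoothness of the metric then follows by induction on the order, for all coefficients at once.\<close>

lemma has_derivative_exp_diagonal:
  fixes c s :: "'n::finite \<Rightarrow> real"
  shows "((\<lambda>x. (\<chi> i j. if i = j then c i * exp (2 * s i * x $ p) else 0) :: real^'n^'n) has_derivative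
    (\<lambda>v. \<chi> i j. if i = j then c i * (2 * s i * v $ p) * exp (2 * s i * x $ p) else 0)) (at x)"
proof (intro has_derivative_vec_lambda)
  fix i j
  show "((\<lambda>x. if i = j then c i * exp (2 * s i * x $ p) else 0) has_derivative
    (\<lambda>v. if i = j then c i * (2 * s i * v $ p) * exp (2 * s i * x $ p) else 0)) (at x)"
    by (cases "i = j")
       (auto intro!: derivative_eq_intros bounded_linear.has_derivative[OF bounded_linear_vec_nth])
qed

lemma smooth_on_sol_metric: "smooth_on S (sol_metric s p)"
proof -
  have "C_k_on k (\<lambda>x. (\<chi> i j. if i = j then c i * exp (2 * s i * x $ p) else 0) :: real^'a^'a) S"
    for k c
  proof (induction k arbitrary: c)
    case 0
    have "continuous (at x) (\<lambda>x. (\<chi> i j. if i = j then c i * exp (2 * s i * x $ p) else 0) :: real^'a^'a)" for x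
      using has_derivative_continuous has_derivative_exp_diagonal by blast
    then show ?case by (simp add: continuous_at_imp_continuous_on)
  next
    case (Suc k)
    have "partial l (\<lambda>x. (\<chi> i j. if i = j then c i * exp (2 * s i * x $ p) else 0) :: real^'a^'a) =
      (\<lambda>x. \<chi> i j. if i = j then c i * (2 * s i * axis l 1 $ p) * exp (2 * s i * x $ p) else 0)" for l
      unfolding partial_def frechet_derivative_at[OF has_derivative_exp_diagonal, symmetric] by simp
    moreover have "(\<lambda>x. (\<chi> i j. if i = j then c i * exp (2 * s i * x $ p) else 0) :: real^'a^'a)
      differentiable (at x)" for x
      using has_derivative_exp_diagonal unfolding differentiable_def by blast
    ultimately show ?case using Suc.IH by simp
  qed
  from this[of _ "\<lambda>_. 1"] show ?thesis
    unfolding smooth_on_def by (simp add: sol_metric_def[abs_def] cong: if_cong)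
qed

lemma matrix_inv_sol_metric:
  "matrix_inv (sol_metric s p x) = (\<chi> i j. if i = j then inverse (exp (2 * s i * x $ p)) else 0)"
proof -
  let ?A = "sol_metric s p x"
  let ?B = "(\<chi> i j. if i = j then inverse (exp (2 * s i * x $ p)) else 0) :: real^'a^'a"
  have AB: "?A ** ?B = mat 1" and BA: "?B ** ?A = mat 1"
    by (auto simp: sol_metric_def matrix_matrix_mult_def mat_def vec_eq_iff if_zero_mult)
  have "?A ** matrix_inv ?A = mat 1"
    unfolding matrix_inv_def using someI_ex[of "\<lambda>B. ?A ** B = mat 1 \<and> B ** ?A = mat 1"] AB BA by blast
  then have "?B ** (?A ** matrix_inv ?A) = ?B" by simp
  then show ?thesis by (simp only: matrix_mul_assoc BA matrix_mul_lid)
qed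

lemma partial_sol_metric:
  "partial i (\<lambda>y. sol_metric s p y $ j $ l) x =
    (if i = p \<and> j = l then 2 * s j * exp (2 * s j * x $ p) else 0)"
proof -
  have D: "(sol_metric s p has_derivative
      (\<lambda>v. \<chi> i j. if i = j then (2 * s i * v $ p) * exp (2 * s i * x $ p) else 0)) (at x)"
    using has_derivative_exp_diagonal[of "\<lambda>_. 1" s p x] by (simp add: sol_metric_def[abs_def] cong: if_cong)
  then have "sol_metric s p differentiable (at x)" unfolding differentiable_def by blast
  from partial_component(1)[OF this, of i j l] show ?thesis
    by (auto simp: frechet_derivative_at[OF D, symmetric] axis_def)
qed


section \<open>Covariant derivatives and Ricci curvature\<close>

lemma christoffel_sol_metric:
  assumes "s p = 0"
  shows "christoffel (sol_metric s p) x k i j =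
    (if i = p \<and> j = k then s k else 0) + (if j = p \<and> i = k then s k else 0)
    - (if k = p \<and> i = j then s i * exp (2 * s i * x $ p) else 0)"
proof -
  have "christoffel (sol_metric s p) x k i j = inverse (exp (2 * s k * x $ p)) / 2 *
      (partial i (\<lambda>y. sol_metric s p y $ j $ k) x + partial j (\<lambda>y. sol_metric s p y $ i $ k) x
        - partial k (\<lambda>y. sol_metric s p y $ i $ j) x)"
    unfolding christoffel_def matrix_inv_sol_metric by (simp add: if_zero_mult if_zero_divide)
  moreover have "inverse (exp (2 * s k * x $ p)) / 2 *
      (if P \<and> j = k then 2 * s j * exp (2 * s j * x $ p) else 0) = (if P \<and> j = k then s k else 0)" for P j
    by simp
  moreover have "inverse (exp (2 * s k * x $ p)) / 2 *
      (if k = p \<and> i = j then 2 * s i * exp (2 * s i * x $ p) else 0) =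
      (if k = p \<and> i = j then s i * exp (2 * s i * x $ p) else 0)"
    using assms by simp
  ultimately show ?thesis
    by (simp only: partial_sol_metric distrib_left right_diff_distrib)
qed

text \<open>The last term is the \<open>e_p\<close>-component of the
  second fundamental form of the level sets of \<open>x_p\<close>. Both summands of the middle term
  contain \<open>X_k\<close> or \<open>Y_k\<close>, so they vanish in leaf directions for horizontal arguments.\<close>

lemma levi_civita_sol_metric:
  assumes "s p = 0"
  shows "levi_civita (sol_metric s p) X Y x $ k = frechet_derivative Y (at x) (X x) $ k
    + s k * (X x $ p * Y x $ k + X x $ k * Y x $ p)
    - (if k = p then \<Sum>i\<in>UNIV. s i * exp (2 * s i * x $ p) * X x $ i * Y x $ i else 0)"
proof -
  have if_and: "(if P \<and> Q then a else 0) = (if P then if Q then a else 0 else (0::real))" for P Q a by simp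
  have "(\<Sum>i\<in>UNIV. \<Sum>j\<in>UNIV. (if i = p \<and> j = k then s k else 0) * X x $ i * Y x $ j) =
      s k * X x $ p * Y x $ k"
    unfolding if_and if_zero_mult sum_if_zero by simp
  moreover have "(\<Sum>i\<in>UNIV. \<Sum>j\<in>UNIV. (if j = p \<and> i = k then s k else 0) * X x $ i * Y x $ j) =
      s k * X x $ k * Y x $ p"
    unfolding if_and if_zero_mult sum_if_zero by simp
  moreover have "(\<Sum>i\<in>UNIV. \<Sum>j\<in>UNIV.
      (if k = p \<and> i = j then s i * exp (2 * s i * x $ p) else 0) * X x $ i * Y x $ j) =
      (if k = p then \<Sum>i\<in>UNIV. s i * exp (2 * s i * x $ p) * X x $ i * Y x $ i else 0)"
    unfolding if_and if_zero_mult sum_if_zero by simp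
  ultimately show ?thesis
    unfolding levi_civita_def christoffel_sol_metric[where s = s, OF assms]
    by (simp only: left_diff_distrib distrib_right distrib_left sum.distrib sum_subtractf
        vector_add_component vec_lambda_beta mult.assoc add_diff_eq)
qed

text \<open>The covariant derivative of \<open>e_p\<close> is the constant diagonal endomorphism with entries \<open>s_k\<close>
  and kills \<open>e_p\<close> itself; differentiating once more along \<open>e_p\<close> squares it, without a contribution
  of coordinate derivatives because it is constant.\<close>

lemma ricci_sol_metric_along:
  assumes "s p = 0"
  shows "ricci (sol_metric s p) x (axis p 1) (axis p 1) = - (\<Sum>i\<in>UNIV. (s i)\<^sup>2)"
proof -
  have nabla: "levi_civita (sol_metric s p) (\<lambda>_. \<xi>) (\<lambda>_. axis p 1) = (\<lambda>_. \<chi> k. s k * \<xi> $ k)" for \<xi>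
    using assms by (auto simp: fun_eq_iff vec_eq_iff levi_civita_sol_metric axis_def mult_if_zero)
  have geodesic: "(\<chi> k. s k * axis p 1 $ k) = 0"
    using assms by (simp add: vec_eq_iff axis_def)
  have bracket: "lie_bracket (\<lambda>_. \<zeta>) (\<lambda>_. \<xi>) = (\<lambda>_. 0)" for \<zeta> \<xi> :: "real^'a"
    by (simp add: lie_bracket_def fun_eq_iff)
  have "curvature (sol_metric s p) (\<lambda>_. \<zeta>) (\<lambda>_. axis p 1) (\<lambda>_. axis p 1) x $ k = - (s k)\<^sup>2 * \<zeta> $ k" for \<zeta> k
    unfolding curvature_def nabla bracket geodesic using assms
    by (simp add: levi_civita_sol_metric power2_eq_square axis_def mult_if_zero if_zero_mult)
  then show ?thesis
    by (simp add: ricci_def trace_def matrix_def sum_negf)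
qed

text \<open>The direction \<open>e_q\<close> splits off as a flat factor.\<close>

lemma ricci_sol_metric_flat:
  assumes "s p = 0" "s q = 0" "q \<noteq> p"
  shows "ricci (sol_metric s p) x (axis q 1) (axis q 1) = 0"
proof -
  have q: "levi_civita (sol_metric s p) (\<lambda>_. \<xi>) (\<lambda>_. axis q 1) = (\<lambda>_. 0)" for \<xi>
    using assms by (auto simp: fun_eq_iff vec_eq_iff levi_civita_sol_metric axis_def if_zero_mult mult_if_zero)
  show ?thesis
    using assms unfolding ricci_def curvature_def q lie_bracket_def
    by (auto simp: trace_def matrix_def levi_civita_sol_metric cong: if_cong)
qed


section \<open>Cartesian space as a manifold\<close>

definition cartesian_atlas :: "(real^'n::finite, 'n) chart set" where
  "cartesian_atlas = {(UNIV, id)}"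

lemma coords_cartesian [simp]: "coords (UNIV, id) W = W"
  by (simp add: coords_def)

lemma transition_cartesian [simp]: "transition (UNIV, id) (UNIV, id) = id"
  by (simp add: transition_def)

lemma smooth_manifold_cartesian: "smooth_manifold euclidean (cartesian_atlas :: (real^'n::finite, 'n) chart set)"
proof -
  obtain \<B> :: "(real^'n) set set" where "countable \<B>" "\<And>C. C \<in> \<B> \<Longrightarrow> open C"
    "\<And>S. open S \<Longrightarrow> \<exists>U. U \<subseteq> \<B> \<and> S = \<Union>U"
    by (metis univ_second_countable)
  then have "second_countable (euclidean :: (real^'n) topology)"
    unfolding second_countable_def open_openin[symmetric]
    by (intro exI[of _ \<B>]) (metis Sup_upper Union_iff subset_eq)
  then show ?thesis
    by (simp add: smooth_manifold_def cartesian_atlas_def smooth_on_id)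
qed

lemma vector_field_cartesian: "vector_field cartesian_atlas W X \<longleftrightarrow> smooth_on W (X (UNIV, id))"
  by (simp add: vector_field_def cartesian_atlas_def)

lemma section_of_cartesian:
  "section_of cartesian_atlas W D X \<longleftrightarrow>
    smooth_on W (X (UNIV, id)) \<and> (\<forall>x\<in>W. X (UNIV, id) x \<in> D (UNIV, id) x)"
  by (simp add: section_of_def vector_field_cartesian) (simp add: cartesian_atlas_def)

lemma foliation_coord_space: "foliation euclidean cartesian_atlas (\<lambda>_ _. coord_space I)"
  unfolding foliation_def
proof (intro conjI exI)
  obtain xs where xs: "set xs = I" "distinct xs"
    using finite_distinct_list[of I] by auto
  define Es :: "(real^'a, 'a) field list" where "Es = map (\<lambda>i _ _. axis i 1) xs"
  have Es: "length Es = card I" "\<forall>E\<in>set Es. vector_field cartesian_atlas UNIV E"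
      "(\<lambda>E. E c x) ` set Es = (\<lambda>i. axis i 1) ` I" for c x
    using xs distinct_card[of xs]
    by (auto simp: Es_def vector_field_cartesian smooth_on_const image_image)
  show "distribution euclidean cartesian_atlas (card I) (\<lambda>_ _. coord_space I)"
    unfolding distribution_def
    by (intro ballI exI[of _ UNIV] exI[of _ Es]) (simp add: Es span_axes dim_coord_space)
  show "involutive euclidean cartesian_atlas (\<lambda>_ _. coord_space I)"
    unfolding involutive_def section_of_cartesian lie_bracket_def
    by (auto simp: cartesian_atlas_def intro!: subspace_diff subspace_coord_space
      intro: frechet_derivative_in_coord_space smooth_on_imp_differentiable)
qed

section \<open>The coordinate foliation\<close>

lemma ip_sol_metric_pos:
  assumes "\<xi> \<noteq> 0"
  shows "0 < ip (sol_metric s p) x \<xi> \<xi>"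
proof -
  from assms obtain i where "\<xi> $ i \<noteq> 0" by (auto simp: vec_eq_iff)
  then show ?thesis
    unfolding ip_sol_metric
    by (intro sum_pos2[of _ i]) (auto simp: mult.assoc zero_less_mult_iff linorder_neq_iff)
qed

lemma riemannian_metric_sol: "riemannian_metric cartesian_atlas (\<lambda>_. sol_metric s p)"
proof -
  have "transpose (sol_metric s p x) = sol_metric s p x" for x
    by (auto simp: transpose_def sol_metric_def vec_eq_iff)
  then show ?thesis
    by (simp add: riemannian_metric_def cartesian_atlas_def smooth_on_sol_metric ip_sol_metric_pos)
qed

lemma horizontal_coord_space:
  fixes s :: "'n::finite \<Rightarrow> real"
  shows "horizontal (\<lambda>_. sol_metric s p) (\<lambda>_ _. coord_space I) = (\<lambda>_ _. coord_space (- I))"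
proof (intro ext set_eqI iffI)
  fix c and x \<xi> :: "real^'n"
  assume *: "\<xi> \<in> horizontal (\<lambda>_. sol_metric s p) (\<lambda>_ _. coord_space I) c x"
  have "\<xi> $ i = 0" if "i \<in> I" for i
  proof -
    have "ip (sol_metric s p) x \<xi> (axis i 1) = 0"
      using * that by (simp add: horizontal_def)
    then show ?thesis
      by (simp add: ip_sol_metric axis_def mult_if_zero)
  qed
  then show "\<xi> \<in> coord_space (- I)" by (simp add: coord_space_def)
next
  fix c and x \<xi> :: "real^'n"
  assume "\<xi> \<in> coord_space (- I)"
  then show "\<xi> \<in> horizontal (\<lambda>_. sol_metric s p) (\<lambda>_ _. coord_space I) c x"
    by (fastforce simp: horizontal_def ip_sol_metric coord_space_def intro!: sum.neutral)
qed

lemma orth_proj_coord_space: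
  "orth_proj (\<lambda>_. sol_metric s p) (\<lambda>_ _. coord_space I) c x \<xi> = (\<chi> i. if i \<in> I then \<xi> $ i else 0)"
  unfolding orth_proj_def
proof (rule the_equality)
  show "(\<chi> i. if i \<in> I then \<xi> $ i else 0) \<in> coord_space I \<and>
    (\<forall>\<zeta>\<in>coord_space I. ip (sol_metric s p) x (\<xi> - (\<chi> i. if i \<in> I then \<xi> $ i else 0)) \<zeta> = 0)"
    by (auto simp: ip_sol_metric coord_space_def intro!: sum.neutral)
next
  fix \<eta> assume \<eta>: "\<eta> \<in> coord_space I \<and> (\<forall>\<zeta>\<in>coord_space I. ip (sol_metric s p) x (\<xi> - \<eta>) \<zeta> = 0)"
  have "\<eta> $ i = \<xi> $ i" if "i \<in> I" for i
  proof -
    have "ip (sol_metric s p) x (\<xi> - \<eta>) (axis i 1) = 0" using \<eta> that by simp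
    then show ?thesis by (simp add: ip_sol_metric axis_def mult_if_zero)
  qed
  then show "\<eta> = (\<chi> i. if i \<in> I then \<xi> $ i else 0)"
    using \<eta> by (auto simp: coord_space_def vec_eq_iff)
qed

text \<open>The horizontal planes are tangent to coordinate surfaces, and the metric on them does not vary
  along the leaves. Hence the covariant derivative of a horizontal field along a horizontal field is
  horizontal, and the zero field witnesses conformality.\<close>

lemma conformal_sol_metric:
  assumes "s p = 0" "p \<notin> I"
  shows "conformal euclidean cartesian_atlas (\<lambda>_. sol_metric s p) (\<lambda>_ _. coord_space I)"
  unfolding conformal_def horizontal_coord_space
proof (intro exI[of _ "\<lambda>_ _. 0"] conjI allI impI ballI)
  show "section_of cartesian_atlas (topspace euclidean) (\<lambda>_ _. coord_space I) (\<lambda>_ _. 0)"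
    by (simp add: section_of_cartesian smooth_on_const subspace_0 subspace_coord_space)
next
  fix W :: "(real^'a) set" and X Y c x
  assume W: "openin euclidean W"
    and X: "section_of cartesian_atlas W (\<lambda>_ _. coord_space (- I)) X"
    and Y: "section_of cartesian_atlas W (\<lambda>_ _. coord_space (- I)) Y"
    and "c \<in> cartesian_atlas" and "x \<in> coords c W"
  then have c: "c = (UNIV, id)" and x: "x \<in> W" by (auto simp: cartesian_atlas_def)
  have nabla_horizontal: "levi_civita (sol_metric s p) (E c) (F c) x $ i = 0"
    if "i \<in> I" and E: "section_of cartesian_atlas W (\<lambda>_ _. coord_space (- I)) E"
      and F: "section_of cartesian_atlas W (\<lambda>_ _. coord_space (- I)) F" for E F i
  proof -
    have "frechet_derivative (F c) (at x) (E c x) \<in> coord_space (- I)"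
      using W x F unfolding c section_of_cartesian
      by (intro frechet_derivative_in_coord_space[of W]) (auto intro: smooth_on_imp_differentiable)
    moreover have "E c x \<in> coord_space (- I)" "F c x \<in> coord_space (- I)"
      using x E F unfolding c section_of_cartesian by auto
    ultimately have "frechet_derivative (F c) (at x) (E c x) $ i = 0" "E c x $ i = 0" "F c x $ i = 0"
      using \<open>i \<in> I\<close> by (auto simp: coord_space_def)
    moreover have "i \<noteq> p" using \<open>i \<in> I\<close> assms(2) by blast
    ultimately show ?thesis using assms by (simp add: levi_civita_sol_metric)
  qed
  show "second_fundamental_form_H (\<lambda>_. sol_metric s p) (\<lambda>_ _. coord_space I) X Y c x =
    ip (sol_metric s p) x (X c x) (Y c x) *\<^sub>R 0"
    using X Y nabla_horizontal unfolding second_fundamental_form_H_def orth_proj_coord_space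
    by (simp add: vec_eq_iff)
qed

text \<open>The coefficient of \<open>e_i\<close> along a frame vector \<open>E\<close> is \<open>g(e_i, E) = g(e_i, e_i) E_i\<close>; the
  claim is the \<open>i\<close>-th component of the expansion of \<open>e_i\<close>, or Parseval's identity for the unit vector
  in this direction. It makes the trace of the second fundamental form independent of the frame.\<close>

lemma orthonormal_frame_parseval:
  assumes frame: "orthonormal_frame M cartesian_atlas (\<lambda>_. sol_metric s p) (\<lambda>_ _. coord_space I) W Es"
    and x: "x \<in> W" and i: "i \<in> I"
  shows "(\<Sum>j<length Es. exp (2 * s i * x $ p) * ((Es ! j) (UNIV, id) x $ i)\<^sup>2) = 1"
proof -
  define e where "e j = (Es ! j) (UNIV, id) x" for j
  define n where "n = length Es"
  define w where "w = axis i 1 - (\<Sum>j<n. ip (sol_metric s p) x (axis i 1) (e j) *\<^sub>R e j)"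
  let ?ip = "ip (sol_metric s p) x"
  have img: "(\<lambda>E. E (UNIV, id) x) ` set Es = e ` {..<n}"
    unfolding e_def n_def by (force simp: in_set_conv_nth)
  have sp: "span (e ` {..<n}) = coord_space I"
    and orth: "\<And>j k. j < n \<Longrightarrow> k < n \<Longrightarrow> ?ip (e j) (e k) = (if j = k then 1 else 0)"
    using frame x unfolding orthonormal_frame_def img[symmetric]
    by (auto simp: cartesian_atlas_def e_def n_def)
  have lin: "linear (?ip \<xi>)" "linear (\<lambda>\<xi>. ?ip \<xi> \<eta>)" for \<xi> \<eta>
    unfolding ip_sol_metric
    by (auto intro!: linearI simp: algebra_simps sum.distrib sum_distrib_left)
  \<comment> \<open>The residue \<open>w\<close> of the frame expansion of \<open>e_i\<close> is orthogonal to its own span, hence zero.\<close>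
  have "?ip w (e k) = 0" if "k < n" for k
    using that unfolding w_def
    by (simp add: linear_diff[OF lin(2)] linear_sum[OF lin(2)] linear_cmul[OF lin(2)] orth mult_if_zero)
  then have "span (e ` {..<n}) \<subseteq> {v. ?ip w v = 0}"
    by (intro span_minimal linear_subspace_kernel lin(1)) auto
  moreover have "w \<in> span (e ` {..<n})"
    unfolding w_def
  proof (intro span_diff span_sum span_mul)
    show "axis i 1 \<in> span (e ` {..<n})" using i by (simp add: sp)
  qed (auto intro: span_base)
  ultimately have "?ip w w = 0" by blast
  then have "w = 0"
    using ip_sol_metric_pos[of w s p x] by fastforce
  then have "(\<Sum>j<n. ?ip (axis i 1) (e j) *\<^sub>R e j) $ i = 1" by (simp add: w_def)
  moreover have "?ip (axis i 1) (e j) = exp (2 * s i * x $ p) * e j $ i" for j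
    by (simp add: ip_sol_metric axis_def mult_if_zero if_zero_mult)
  ultimately show ?thesis
    by (simp add: e_def n_def power2_eq_square mult.assoc)
qed

text \<open>For a vertical field \<open>E\<close> the horizontal part of \<open>\<nabla>_E E\<close> is a multiple of \<open>e_p\<close>, in which
  each rate \<open>s_i\<close> is weighted by \<open>- g(e_i, e_i) E_i^2\<close>. By Parseval these weights add up to \<open>- 1\<close>
  over an orthonormal frame, so the trace is \<open>- \<Sum> s_i\<close>.\<close>

lemma minimal_leaves_sol_metric:
  assumes "s p = 0" "p \<notin> I" "(\<Sum>i\<in>I. s i) = 0"
  shows "minimal_leaves euclidean cartesian_atlas (\<lambda>_. sol_metric s p) (\<lambda>_ _. coord_space I)"
  unfolding minimal_leaves_def
proof (intro allI impI ballI)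
  fix W Es c x
  assume frame: "orthonormal_frame euclidean cartesian_atlas (\<lambda>_. sol_metric s p) (\<lambda>_ _. coord_space I) W Es"
    and "c \<in> cartesian_atlas" and "x \<in> coords c W"
  then have c: "c = (UNIV, id)" and x: "x \<in> W" by (auto simp: cartesian_atlas_def)
  have W: "open W" using frame by (simp add: orthonormal_frame_def)
  have nabla: "levi_civita (sol_metric s p) (E c) (E c) x $ k =
      (if k = p then - (\<Sum>i\<in>I. s i * (exp (2 * s i * x $ p) * (E c x $ i)\<^sup>2)) else 0)"
    if "E \<in> set Es" "k \<notin> I" for E k
  proof -
    have sec: "smooth_on W (E c)" "\<And>y. y \<in> W \<Longrightarrow> E c y \<in> coord_space I"
      using frame that unfolding orthonormal_frame_def section_of_cartesian c by auto
    then have "frechet_derivative (E c) (at x) (E c x) \<in> coord_space I"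
      using W x by (intro frechet_derivative_in_coord_space[of W]) (auto intro: smooth_on_imp_differentiable)
    moreover have "(\<Sum>i\<in>UNIV. s i * exp (2 * s i * x $ p) * E c x $ i * E c x $ i) =
      (\<Sum>i\<in>I. s i * (exp (2 * s i * x $ p) * (E c x $ i)\<^sup>2))"
      using sec(2)[OF x] by (intro sum.mono_neutral_cong_right) (auto simp: coord_space_def power2_eq_square)
    ultimately show ?thesis
      using sec(2)[OF x] that(2) assms(1) by (auto simp: coord_space_def levi_civita_sol_metric)
  qed
  have "(\<Sum>j<length Es. \<Sum>i\<in>I. s i * (exp (2 * s i * x $ p) * ((Es ! j) c x $ i)\<^sup>2)) =
    (\<Sum>i\<in>I. s i * (\<Sum>j<length Es. exp (2 * s i * x $ p) * ((Es ! j) c x $ i)\<^sup>2))"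
    by (subst sum.swap) (simp add: sum_distrib_left)
  also have "\<dots> = (\<Sum>i\<in>I. s i)"
    unfolding c by (simp add: orthonormal_frame_parseval[OF frame x])
  finally have trace: "(\<Sum>j<length Es. \<Sum>i\<in>I. s i * (exp (2 * s i * x $ p) * ((Es ! j) c x $ i)\<^sup>2)) = 0"
    using assms(3) by simp
  have "second_fundamental_form_V (\<lambda>_. sol_metric s p) (\<lambda>_ _. coord_space I) E E c x =
    (\<chi> k. if k = p then - (\<Sum>i\<in>I. s i * (exp (2 * s i * x $ p) * (E c x $ i)\<^sup>2)) else 0)"
    if "E \<in> set Es" for E
    using nabla[OF that] assms(2)
    unfolding second_fundamental_form_V_def horizontal_coord_space orth_proj_coord_space
    by (auto simp: vec_eq_iff)
  then show "(\<Sum>j<length Es. second_fundamental_form_V (\<lambda>_. sol_metric s p) (\<lambda>_ _. coord_space I)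
      (Es ! j) (Es ! j) c x) = 0"
    using trace by (simp add: vec_eq_iff sum_negf sum_if_zero cong: if_cong)
qed

lemma orthonormal_frame_axes:
  assumes "s p = 0" "s q = 0" "p \<noteq> q" "- I = {p, q}"
  shows "orthonormal_frame euclidean cartesian_atlas (\<lambda>_. sol_metric s p)
    (horizontal (\<lambda>_. sol_metric s p) (\<lambda>_ _. coord_space I)) UNIV [\<lambda>_ _. axis p 1, \<lambda>_ _. axis q 1]"
  unfolding orthonormal_frame_def horizontal_coord_space
proof (intro conjI ballI allI impI)
  let ?Es = "[\<lambda>_ _. axis p 1, \<lambda>_ _. axis q 1]"
  show "section_of cartesian_atlas UNIV (\<lambda>_ _. coord_space (- I)) E" if "E \<in> set ?Es" for E
    using that assms(4) by (auto simp: section_of_cartesian smooth_on_const)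
  show "span ((\<lambda>E. E c x) ` set ?Es) = coord_space (- I)" for c x
    using span_axes[of "- I"] assms(4) by simp
  have "ip (sol_metric s p) x (axis i 1) (axis j 1) = (if i = j then exp (2 * s i * x $ p) else 0)" for x i j
    by (simp add: ip_sol_metric axis_def mult_if_zero)
  then show "ip (sol_metric s p) x ((?Es ! i) c x) ((?Es ! j) c x) = (if i = j then 1 else 0)"
    if "i < length ?Es" "j < length ?Es" for c x i j
    using that assms(1-3) by (auto simp: less_2_cases_iff numeral_2_eq_2 less_Suc_eq)
qed simp

theorem mainTheorem2:
  fixes m :: nat
  assumes "m > 3" and "CARD('n::finite) = m"
  shows "\<exists>(M :: (real^'n) topology) (A :: (real^'n, 'n) chart set) g V W X Y.
    riemannian_manifold M A g \<and>
    foliation M A V \<and> codimension A g V 2 \<and>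
    conformal M A g V \<and> minimal_leaves M A g V \<and>
    orthonormal_frame M A g (horizontal g V) W [X, Y] \<and>
    \<not> ricci_condition A g W X Y"
proof -
  have "4 \<le> card (UNIV :: 'n set)" using assms by simp
  then obtain S :: "'n set" where "card S = 4" using obtain_subset_with_card_n by metis
  then obtain p q u v :: 'n where d: "distinct [p, q, u, v]"
    by (auto simp: card_Suc_eq numeral_eq_Suc)
  define s :: "'n \<Rightarrow> real" where "s i = (if i = u then 1 else if i = v then - 1 else 0)" for i
  define I where "I = - {p, q}"
  let ?g = "\<lambda>_ :: (real^'n, 'n) chart. sol_metric s p"
  let ?V = "\<lambda>(_ :: (real^'n, 'n) chart) (_ :: real^'n). coord_space I"
  have s: "s p = 0" "s q = 0" "p \<noteq> q" "- I = {p, q}" "p \<notin> I" using d by (auto simp: s_def I_def)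
  have "(\<Sum>i\<in>I. s i) = (\<Sum>i\<in>{u, v}. s i)"
    using d by (intro sum.mono_neutral_right) (auto simp: s_def I_def)
  then have tr: "(\<Sum>i\<in>I. s i) = 0" using d by (auto simp: s_def)
  have "(\<Sum>i\<in>UNIV. (s i)\<^sup>2) \<ge> (\<Sum>i\<in>{u}. (s i)\<^sup>2)"
    by (rule sum_mono2) auto
  then have "(\<Sum>i\<in>UNIV. (s i)\<^sup>2) \<noteq> 0" by (auto simp: s_def)
  with s have "\<not> ricci_condition cartesian_atlas ?g UNIV (\<lambda>_ _. axis p 1) (\<lambda>_ _. axis q 1)"
    by (simp add: ricci_condition_def cartesian_atlas_def ricci_sol_metric_along ricci_sol_metric_flat)
  moreover have "riemannian_manifold euclidean cartesian_atlas ?g"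
    by (simp add: riemannian_manifold_def smooth_manifold_cartesian riemannian_metric_sol)
  moreover have "codimension cartesian_atlas ?g ?V 2"
    using s by (simp add: codimension_def horizontal_coord_space dim_coord_space)
  moreover note foliation_coord_space[of I] conformal_sol_metric[of s p I, OF s(1,5)]
    minimal_leaves_sol_metric[of s p I, OF s(1,5) tr] orthonormal_frame_axes[of s p q I, OF s(1-4)]
  ultimately have "riemannian_manifold euclidean cartesian_atlas ?g \<and>
      foliation euclidean cartesian_atlas ?V \<and> codimension cartesian_atlas ?g ?V 2 \<and>
      conformal euclidean cartesian_atlas ?g ?V \<and> minimal_leaves euclidean cartesian_atlas ?g ?V \<and>
      orthonormal_frame euclidean cartesian_atlas ?g (horizontal ?g ?V) UNIV
        [\<lambda>_ _. axis p 1, \<lambda>_ _. axis q 1] \<and>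
      \<not> ricci_condition cartesian_atlas ?g UNIV (\<lambda>_ _. axis p 1) (\<lambda>_ _. axis q 1)"
    by (intro conjI)
  then show ?thesis
    by (intro exI[of _ euclidean] exI[of _ cartesian_atlas] exI[of _ ?g] exI[of _ ?V] exI[of _ UNIV]
      exI[of _ "\<lambda>_ _. axis p 1"] exI[of _ "\<lambda>_ _. axis q 1"])
qed

end
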